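(* Let $\tilde f=\tilde f(t,\alpha,\theta,\omega_\alpha,\omega_\theta)$ be a solution of the gravitational Vlasov-Poisson system on the unit sphere $\mathbb S^2$ in local coordinates (recalled in the context) having the form $$\tilde f(t,\alpha,\theta,\omega_\alpha,\omega_\theta)=\frac{\delta(\alpha-\pi/2)}{\sin^2\alpha}\otimes\delta(\omega_\alpha)\,g(t,\theta,\omega_\theta),$$ where $\delta$ is the Dirac delta and $g$ is a distribution function on the great circle $G=\{\alpha=\pi/2\}$. Let $\rho_g(t,\theta)=\int_{\mathbb R}g(t,\theta,\omega_\theta)\,d\omega_\theta$. Then $g$ and $\rho_g$ satisfy, in the distributional sense, $$\begin{cases}\partial_t g+\omega_\theta\,\partial_\theta g+F(t,\theta)\,\partial_{\omega_\theta}g=0,\\ F(t,\theta)=W*_\theta\partial_\theta\rho_g,\\ \rho_g(t,\theta)=\int_{\mathbb R}g(t,\theta,\omega_\theta)\,d\omega_\theta,\end{cases}$$ where $W(\theta)=\frac1{2\pi}\log\left|\cot\frac{\theta}{2}\right|$ for $\theta\in[0,2\pi)$ and $*_\theta$ denotes ($2\pi$-periodic) convolution in $\theta$.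
   Context: Points of $\mathbb S^2$ are parametrized by $\mathbf x(\alpha,\theta)=(\sin\alpha\cos\theta,\sin\alpha\sin\theta,\cos\alpha)$, $\alpha\in[0,\pi]$, $\theta\in[0,2\pi)$; $\omega_\alpha=\dot\alpha$ and $\omega_\theta=\dot\theta$ are the velocity coordinates. The gravitational Vlasov-Poisson system on $\mathbb S^2$ in local coordinates is $$\partial_t\tilde f+\omega_\alpha\partial_\alpha\tilde f+\omega_\theta\partial_\theta\tilde f+(\partial_\alpha\tilde U+\omega_\theta^2\sin\alpha\cos\alpha)\,\partial_{\omega_\alpha}\tilde f+\Big(\tfrac1{\sin^2\alpha}\partial_\theta\tilde U-2\omega_\alpha\omega_\theta\cot\alpha\Big)\partial_{\omega_\theta}\tilde f=0,$$ $$\tilde U(t,\alpha,\theta)=\frac1{4\pi}\int_0^{2\pi}\!\!\int_0^{\pi}\tilde\rho(t,\alpha',\theta')\log\left[\frac{1+\mathbf x(\alpha,\theta)\cdot\mathbf x(\alpha',\theta')}{1-\mathbf x(\alpha,\theta)\cdot\mathbf x(\alpha',\theta')}\right]\sin\alpha'\,d\alpha'\,d\theta',$$ $$\tilde\rho(t,\alpha,\theta)=\int_{\mathbb R^2}\tilde f(t,\alpha,\theta,\omega_\alpha,\omega_\theta)\,\sin\alpha\,d\omega_\alpha\,d\omega_\theta .$$ Distributional sense: the first equation holds when tested against functions $\phi\in C_0^\infty([0,2\pi)\times\mathbb R)$ of $(\theta,\omega_\theta)$ with the pairing $\langle u,\phi\rangle=\int_{\mathbb R}\int_0^{2\pi}u\,\phi\,d\theta\,d\omega_\theta$.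 For the restricted configuration, $\partial_\theta \tilde U$ and $\partial_\alpha\tilde U$ are evaluated at $\alpha=\pi/2$. *)

theory Defs
  imports "HOL-Analysis.Analysis" "HOL-Probability.Giry_Monad"
begin

section \<open>Test functions and distributions\<close>

primrec times_cont_diff :: "nat \<Rightarrow> ('a::euclidean_space \<Rightarrow> real) \<Rightarrow> bool" where
  "times_cont_diff 0 f \<longleftrightarrow> continuous_on UNIV f"
| "times_cont_diff (Suc k) f \<longleftrightarrow>
     f differentiable_on UNIV \<and>
     (\<forall>b\<in>Basis. times_cont_diff k (\<lambda>x. frechet_derivative f (at x) b))"

definition smooth :: "('a::euclidean_space \<Rightarrow> real) \<Rightarrow> bool" where
  "smooth f \<longleftrightarrow> (\<forall>k. times_cont_diff k f)"

text \<open>The angle \<open>\<theta> \<in> [0, 2 \<pi>)\<close> is a coordinate on a circle: test functions are \<open>2 \<pi>\<close>-periodic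
  in \<open>\<theta>\<close> and compactly supported in the remaining variables. On phase space, with coordinates
  \<open>(\<alpha>, \<theta>, \<omega>\<^sub>\<alpha>, \<omega>\<^sub>\<theta>)\<close>, they vanish near the poles, where the coordinates are singular.\<close>

definition circle_tests :: "(real \<Rightarrow> real) set" where
  "circle_tests = {\<psi>. smooth \<psi> \<and> (\<forall>\<theta>. \<psi> (\<theta> + 2 * pi) = \<psi> \<theta>)}"

definition circle_phase_tests :: "(real \<times> real \<Rightarrow> real) set" where
  "circle_phase_tests =
     {\<phi>. smooth \<phi> \<and> (\<forall>\<theta> w. \<phi> (\<theta> + 2 * pi, w) = \<phi> (\<theta>, w)) \<and>
         (\<exists>R. \<forall>\<theta> w. \<phi> (\<theta>, w) \<noteq> 0 \<longrightarrow> \<bar>w\<bar> \<le> R)}"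

definition sphere_phase_tests :: "(real \<times> real \<times> real \<times> real \<Rightarrow> real) set" where
  "sphere_phase_tests =
     {\<Phi>. smooth \<Phi> \<and> (\<forall>\<alpha> \<theta> a w. \<Phi> (\<alpha>, \<theta> + 2 * pi, a, w) = \<Phi> (\<alpha>, \<theta>, a, w)) \<and>
         (\<exists>\<epsilon>>0. \<exists>R. \<forall>\<alpha> \<theta> a w. \<Phi> (\<alpha>, \<theta>, a, w) \<noteq> 0 \<longrightarrow>
            \<epsilon> \<le> \<alpha> \<and> \<alpha> \<le> pi - \<epsilon> \<and> \<bar>a\<bar> \<le> R \<and> \<bar>w\<bar> \<le> R)}"

text \<open>Distributions on the circle are represented by their action on \<open>circle_tests\<close>.\<close>

type_synonym circle_dist = "(real \<Rightarrow> real) \<Rightarrow> real"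

definition dist_of_fun :: "(real \<Rightarrow> real) \<Rightarrow> circle_dist" where
  "dist_of_fun u = (\<lambda>\<psi>. LBINT \<theta>:{0..<2 * pi}. u \<theta> * \<psi> \<theta>)"

definition dist_deriv :: "circle_dist \<Rightarrow> circle_dist" where
  "dist_deriv T = (\<lambda>\<psi>. - T (deriv \<psi>))"

text \<open>Convolution of a \<open>2 \<pi>\<close>-periodic function with a distribution on the circle: by duality, the
  distribution acts on the convolution of the test function with the reflected kernel.\<close>

definition circle_conv :: "(real \<Rightarrow> real) \<Rightarrow> circle_dist \<Rightarrow> circle_dist" where
  "circle_conv K T = (\<lambda>\<psi>. T (\<lambda>\<theta>'. LBINT \<theta>:{0..<2 * pi}. K (\<theta> - \<theta>') * \<psi> \<theta>))"

definition represents :: "(real \<Rightarrow> real) \<Rightarrow> circle_dist \<Rightarrow> bool" where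
  "represents u T \<longleftrightarrow>
     set_integrable lborel {0..<2 * pi} u \<and> (\<forall>\<psi>\<in>circle_tests. dist_of_fun u \<psi> = T \<psi>)"


section \<open>The gravitational Vlasov-Poisson system on the sphere\<close>

definition sphere_point :: "real \<Rightarrow> real \<Rightarrow> real ^ 3" where
  "sphere_point \<alpha> \<theta> = vector [sin \<alpha> * cos \<theta>, sin \<alpha> * sin \<theta>, cos \<alpha>]"

definition log_kernel :: "real \<Rightarrow> real \<Rightarrow> real \<Rightarrow> real \<Rightarrow> real" where
  "log_kernel \<alpha> \<theta> \<alpha>' \<theta>' =
     ln ((1 + sphere_point \<alpha> \<theta> \<bullet> sphere_point \<alpha>' \<theta>') /
         (1 - sphere_point \<alpha> \<theta> \<bullet> sphere_point \<alpha>' \<theta>'))"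

text \<open>A singular phase-space distribution is a Borel measure \<open>m\<close> in the coordinates
  \<open>(\<alpha>, \<theta>, \<omega>\<^sub>\<alpha>, \<omega>\<^sub>\<theta>)\<close>, a function \<open>f\<close> corresponding to \<open>f d\<alpha> d\<theta> d\<omega>\<^sub>\<alpha> d\<omega>\<^sub>\<theta>\<close>, without the
  Riemannian volume factor. Likewise the spatial density \<open>\<rho>\<close> is the measure \<open>\<rho> d\<alpha> d\<theta>\<close>; the two
  factors \<open>sin \<alpha>\<close> of the system are those in \<open>spatial_density\<close> and \<open>potential\<close>.\<close>

type_synonym sphere_state = "(real \<times> real \<times> real \<times> real) measure"

definition spatial_density :: "sphere_state \<Rightarrow> (real \<times> real) measure" where
  "spatial_density m =
     distr (density m (\<lambda>(\<alpha>, \<theta>, a, w). ennreal (sin \<alpha>))) borel (\<lambda>(\<alpha>, \<theta>, a, w). (\<alpha>, \<theta>))"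

definition potential :: "sphere_state \<Rightarrow> real \<Rightarrow> real \<Rightarrow> real" where
  "potential m \<alpha> \<theta> =
     1 / (4 * pi) *
     (\<integral>p. log_kernel \<alpha> \<theta> (fst p) (snd p) * sin (fst p) \<partial>spatial_density m)"

text \<open>The partial derivatives of the potential as functions \<open>A\<close>, \<open>B\<close> that have values on every
  parallel, so that they can be multiplied with a state concentrated on one. In \<open>\<theta>\<close> the derivative
  is the distributional one along each parallel. In \<open>\<alpha>\<close> it is the symmetric derivative, which is
  the classical derivative where that exists: the potential of a mass carried by a great circle is
  in general only one-sidedly differentiable across that circle, its normal derivative having a
  jump proportional to the line density. The symmetric derivative is the principal value.\<close>

definition potential_gradient ::
    "sphere_state \<Rightarrow> (real \<Rightarrow> real \<Rightarrow> real) \<Rightarrow> (real \<Rightarrow> real \<Rightarrow> real) \<Rightarrow> bool" where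
  "potential_gradient m A B \<longleftrightarrow>
     (\<forall>\<alpha>\<in>{0<..<pi}.
        (AE \<theta> in lborel. integrable (spatial_density m)
           (\<lambda>p. log_kernel \<alpha> \<theta> (fst p) (snd p) * sin (fst p))) \<and>
        set_integrable lborel {0..<2 * pi} (potential m \<alpha>) \<and>
        represents (B \<alpha>) (dist_deriv (dist_of_fun (potential m \<alpha>))) \<and>
        (\<forall>\<theta>\<in>{0..<2 * pi}.
           ((\<lambda>h. (potential m (\<alpha> + h) \<theta> - potential m (\<alpha> - h) \<theta>) / (2 * h))
              \<longlongrightarrow> A \<alpha> \<theta>) (at 0)))"

text \<open>The negative of the formal transpose of the transport operator, where \<open>c \<partial>\<^sub>z\<close> has the
  transpose \<open>\<Phi> \<mapsto> - \<partial>\<^sub>z (c \<Phi>)\<close>. The fourth coefficient depends on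
  its own variable, so that the transpose is not simply \<open>- c \<partial>\<^sub>z\<close>.\<close>

definition sphere_transport_dual ::
    "(real \<Rightarrow> real \<Rightarrow> real) \<Rightarrow> (real \<Rightarrow> real \<Rightarrow> real) \<Rightarrow>
     (real \<times> real \<times> real \<times> real \<Rightarrow> real) \<Rightarrow> real \<times> real \<times> real \<times> real \<Rightarrow> real" where
  "sphere_transport_dual A B \<Phi> = (\<lambda>(\<alpha>, \<theta>, a, w).
       deriv (\<lambda>x. a * \<Phi> (x, \<theta>, a, w)) \<alpha>
     + deriv (\<lambda>x. w * \<Phi> (\<alpha>, x, a, w)) \<theta>
     + deriv (\<lambda>x. (A \<alpha> \<theta> + w\<^sup>2 * sin \<alpha> * cos \<alpha>) * \<Phi> (\<alpha>, \<theta>, x, w)) a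
     + deriv (\<lambda>x. (1 / (sin \<alpha>)\<^sup>2 * B \<alpha> \<theta> - 2 * a * x * cot \<alpha>) * \<Phi> (\<alpha>, \<theta>, a, x)) w)"

text \<open>Distributional solutions on a time interval \<open>I\<close>. The pairing with a fixed test function of the
  phase-space variables is differentiable in time.\<close>

definition sphere_VP_solution :: "real set \<Rightarrow> (real \<Rightarrow> sphere_state) \<Rightarrow> bool" where
  "sphere_VP_solution I f \<longleftrightarrow>
     (\<forall>t\<in>I. sets (f t) = sets borel \<and>
            (AE (\<alpha>, \<theta>, a, w) in f t. \<alpha> \<in> {0<..<pi} \<and> \<theta> \<in> {0..<2 * pi})) \<and>
     (\<exists>A B. \<forall>t\<in>I.
        potential_gradient (f t) (A t) (B t) \<and>
        (\<forall>\<Phi>\<in>sphere_phase_tests.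
           integrable (f t) \<Phi> \<and>
           integrable (f t) (sphere_transport_dual (A t) (B t) \<Phi>) \<and>
           ((\<lambda>s. \<integral>z. \<Phi> z \<partial>f s) has_real_derivative
              (\<integral>z. sphere_transport_dual (A t) (B t) \<Phi> z \<partial>f t)) (at t within I)))"

text \<open>The state \<open>\<delta>(\<alpha> - \<pi>/2) / sin\<^sup>2 \<alpha> \<otimes> \<delta>(\<omega>\<^sub>\<alpha>) g(\<theta>, \<omega>\<^sub>\<theta>)\<close>.\<close>

definition great_circle_state :: "(real \<Rightarrow> real \<Rightarrow> real) \<Rightarrow> sphere_state" where
  "great_circle_state g =
     distr
       (density (return borel (pi / 2)) (\<lambda>\<alpha>. ennreal (1 / (sin \<alpha>)\<^sup>2)) \<Otimes>\<^sub>M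
        return borel (0::real) \<Otimes>\<^sub>M
        density lborel (\<lambda>(\<theta>, w). ennreal (indicator {0..<2 * pi} \<theta> * g \<theta> w)))
       borel
       (\<lambda>(\<alpha>, a, \<theta>, w). (\<alpha>, \<theta>, a, w))"


section \<open>The reduced system on the great circle\<close>

definition circle_distribution_function :: "(real \<Rightarrow> real \<Rightarrow> real) \<Rightarrow> bool" where
  "circle_distribution_function g \<longleftrightarrow>
     (\<forall>\<theta>\<in>{0..<2 * pi}. \<forall>w. 0 \<le> g \<theta> w) \<and>
     set_integrable lborel ({0..<2 * pi} \<times> UNIV) (\<lambda>(\<theta>, w). g \<theta> w)"

definition circle_density :: "(real \<Rightarrow> real \<Rightarrow> real) \<Rightarrow> real \<Rightarrow> real" where
  "circle_density g \<theta> = (LBINT w. g \<theta> w)"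

definition W :: "real \<Rightarrow> real" where
  "W \<theta> = 1 / (2 * pi) * ln \<bar>cot (\<theta> / 2)\<bar>"

definition circle_pairing :: "(real \<Rightarrow> real \<Rightarrow> real) \<Rightarrow> (real \<times> real \<Rightarrow> real) \<Rightarrow> real" where
  "circle_pairing u \<phi> = (LBINT z:{0..<2 * pi} \<times> UNIV. u (fst z) (snd z) * \<phi> z)"

definition circle_transport_dual ::
    "(real \<Rightarrow> real) \<Rightarrow> (real \<times> real \<Rightarrow> real) \<Rightarrow> real \<times> real \<Rightarrow> real" where
  "circle_transport_dual F \<phi> = (\<lambda>(\<theta>, w).
       deriv (\<lambda>x. w * \<phi> (x, w)) \<theta> + deriv (\<lambda>x. F \<theta> * \<phi> (\<theta>, x)) w)"

definition circle_VP_solution ::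
    "real set \<Rightarrow> (real \<Rightarrow> real \<Rightarrow> real \<Rightarrow> real) \<Rightarrow> (real \<Rightarrow> real \<Rightarrow> real) \<Rightarrow> (real \<Rightarrow> real \<Rightarrow> real) \<Rightarrow> bool" where
  "circle_VP_solution I g \<rho> F \<longleftrightarrow>
     (\<forall>t\<in>I.
        (\<forall>\<phi>\<in>circle_phase_tests.
           set_integrable lborel ({0..<2 * pi} \<times> UNIV) (\<lambda>z. g t (fst z) (snd z) * \<phi> z) \<and>
           set_integrable lborel ({0..<2 * pi} \<times> UNIV)
             (\<lambda>z. g t (fst z) (snd z) * circle_transport_dual (F t) \<phi> z) \<and>
           ((\<lambda>s. circle_pairing (g s) \<phi>) has_real_derivative
              circle_pairing (g t) (circle_transport_dual (F t) \<phi>)) (at t within I)) \<and>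
        represents (F t) (circle_conv W (dist_deriv (dist_of_fun (\<rho> t)))) \<and>
        (\<forall>\<theta>\<in>{0..<2 * pi}. \<rho> t \<theta> = (LBINT w. g t \<theta> w)))"

end

theory Submission
  imports Defs
begin

text \<open>A test function \<open>\<phi>\<close> on the phase space of the great circle extends to the test function
  \<open>b(\<alpha> - \<pi>/2) b(\<omega>\<^sub>\<alpha>) \<phi>(\<theta>, \<omega>\<^sub>\<theta>)\<close> of the sphere, where \<open>b\<close> is an even bump function with
  \<open>b(0) = 1\<close>. On the support of the state, \<open>\<omega>\<^sub>\<alpha> = 0\<close> and \<open>\<alpha> = \<pi>/2\<close> remove the \<open>\<alpha>\<close>-transport and the
  curvature terms, and \<open>b'(0) = 0\<close> removes the normal force, whatever its value; what remains is
  the transport operator of the circle with the force \<open>\<partial>\<^sub>\<theta> U\<close> at \<open>\<alpha> = \<pi>/2\<close>. By the half-angle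
  formulas the logarithmic kernel on the great circle is \<open>4 \<pi> W(\<theta> - \<theta>')\<close>, so that
  \<open>U = W * \<rho>\<^sub>g\<close> there, and the derivative moves to \<open>\<rho>\<^sub>g\<close> by Fubini's theorem and differentiation of
  the convolution of \<open>W\<close> with a test function.\<close>


section \<open>Smooth functions\<close>

lemma has_derivative_frechet:
  assumes "f differentiable_on UNIV"
  shows "(f has_derivative frechet_derivative f (at x)) (at x)"
  using assms by (simp add: differentiable_on_def frechet_derivative_works)

text \<open>By uniqueness of the derivative, any explicit derivative may replace
  \<open>frechet_derivative\<close> in the recursion. All closure properties below go through this
  rule.\<close>

lemma times_cont_diff_SucI:
  assumes "\<And>x. (f has_derivative f' x) (at x)"
    and "\<And>b. b \<in> Basis \<Longrightarrow> times_cont_diff k (\<lambda>x. f' x b)"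
  shows "times_cont_diff (Suc k) f"
proof -
  have eq: "frechet_derivative f (at x) = f' x" for x
    using frechet_derivative_at[OF assms(1)] by simp
  have "f differentiable_on UNIV"
    using assms(1) by (auto simp: differentiable_on_def differentiable_def)
  then show ?thesis
    using assms(2) by (simp add: eq)
qed

lemma times_cont_diff_SucD: "times_cont_diff (Suc k) f \<Longrightarrow> times_cont_diff k f"
proof (induction k arbitrary: f)
  case 0
  then show ?case by (simp add: differentiable_imp_continuous_on)
next
  case (Suc k)
  then show ?case by (metis times_cont_diff.simps(2))
qed

lemma times_cont_diff_const: "times_cont_diff k (\<lambda>x. c)"
proof (induction k arbitrary: c)
  case (Suc k)
  show ?case
    by (rule times_cont_diff_SucI[where f' = "\<lambda>x h. 0"]) (auto intro: Suc)
qed simp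

lemma times_cont_diff_add:
  "times_cont_diff k f \<Longrightarrow> times_cont_diff k g \<Longrightarrow> times_cont_diff k (\<lambda>x. f x + g x)"
proof (induction k arbitrary: f g)
  case 0
  then show ?case by (simp add: continuous_on_add)
next
  case (Suc k)
  show ?case
    by (rule times_cont_diff_SucI[OF has_derivative_add[OF has_derivative_frechet has_derivative_frechet]])
      (use Suc in auto)
qed

lemma times_cont_diff_mult:
  "times_cont_diff k f \<Longrightarrow> times_cont_diff k g \<Longrightarrow> times_cont_diff k (\<lambda>x. f x * g x)"
proof (induction k arbitrary: f g)
  case 0
  then show ?case by (simp add: continuous_on_mult)
next
  case (Suc k)
  have "times_cont_diff k f" "times_cont_diff k g"
    using Suc.prems times_cont_diff_SucD by blast+
  then show ?case
    by (intro times_cont_diff_SucI[OF has_derivative_mult[OF has_derivative_frechet has_derivative_frechet]]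
        times_cont_diff_add Suc.IH) (use Suc.prems in auto)
qed

lemma times_cont_diff_sum:
  "finite A \<Longrightarrow> (\<And>i. i \<in> A \<Longrightarrow> times_cont_diff k (f i)) \<Longrightarrow> times_cont_diff k (\<lambda>x. \<Sum>i\<in>A. f i x)"
  by (induction A rule: finite_induct) (auto intro: times_cont_diff_const times_cont_diff_add)

text \<open>Each partial derivative of the composition is a finite sum of constants times partial
  derivatives of \<open>f\<close> composed with the same affine map, so the induction closes once
  \<open>f\<close> is generalised.\<close>

lemma times_cont_diff_affine:
  fixes L :: "'a::euclidean_space \<Rightarrow> 'b::euclidean_space"
  assumes L: "bounded_linear L"
  shows "times_cont_diff k f \<Longrightarrow> times_cont_diff k (\<lambda>x. f (L x + c))"
proof (induction k arbitrary: f)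
  case 0
  have "continuous_on UNIV (\<lambda>x. L x + c)"
    by (intro continuous_on_add continuous_on_const linear_continuous_on L)
  with 0 show ?case
    using continuous_on_compose2[of UNIV f UNIV "\<lambda>x. L x + c"] by simp
next
  case (Suc k)
  define D where "D x h = (\<Sum>e\<in>Basis. (L h \<bullet> e) * frechet_derivative f (at (L x + c)) e)" for x h
  have D: "((\<lambda>x. f (L x + c)) has_derivative D x) (at x)" for x
  proof -
    have f: "(f has_derivative frechet_derivative f (at (L x + c))) (at (L x + c))"
      using Suc.prems by (auto intro: has_derivative_frechet)
    have "((\<lambda>x. f (L x + c)) has_derivative (\<lambda>h. frechet_derivative f (at (L x + c)) (L h))) (at x)"
      by (rule has_derivative_compose[where f = "\<lambda>x. L x + c", OF _ f])
        (auto intro!: derivative_eq_intros bounded_linear.has_derivative[OF L])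
    moreover have "frechet_derivative f (at (L x + c)) (L h) = D x h" for h
    proof -
      have lin: "linear (frechet_derivative f (at (L x + c)))"
        using f has_derivative_linear by blast
      have "frechet_derivative f (at (L x + c)) (\<Sum>e\<in>Basis. (L h \<bullet> e) *\<^sub>R e) = D x h"
        unfolding D_def linear_sum[OF lin] linear_scale[OF lin] by simp
      then show ?thesis by (simp add: euclidean_representation)
    qed
    ultimately show ?thesis by simp
  qed
  show ?case
    by (rule times_cont_diff_SucI[OF D], unfold D_def,
        intro times_cont_diff_sum times_cont_diff_mult times_cont_diff_const Suc.IH)
      (use Suc.prems in auto)
qed

lemma smooth_const: "smooth (\<lambda>x. c)"
  by (simp add: smooth_def times_cont_diff_const)

lemma smooth_mult: "smooth f \<Longrightarrow> smooth g \<Longrightarrow> smooth (\<lambda>x. f x * g x)"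
  by (simp add: smooth_def times_cont_diff_mult)

lemma smooth_affine: "bounded_linear L \<Longrightarrow> smooth f \<Longrightarrow> smooth (\<lambda>x. f (L x + c))"
  by (simp add: smooth_def times_cont_diff_affine)

lemma times_cont_diff_Suc_real:
  assumes "\<And>x. (f has_real_derivative f' x) (at x)" and "times_cont_diff k f'"
  shows "times_cont_diff (Suc k) f"
  by (rule times_cont_diff_SucI[where f' = "\<lambda>x h. f' x * h"])
    (use assms in \<open>auto simp: has_field_derivative_def\<close>)

text \<open>Test functions are smooth in the Frechet sense while the transport operators use
  \<open>deriv\<close>. In dimension one the Frechet derivative is multiplication by its value at 1,
  the only basis vector, which links the two.\<close>

lemma smooth_real_derivative:
  fixes f :: "real \<Rightarrow> real"
  assumes "smooth f"
  shows "(f has_real_derivative deriv f x) (at x)" and "smooth (deriv f)"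
proof -
  have Suc: "times_cont_diff (Suc k) f" for k
    using assms by (simp add: smooth_def del: times_cont_diff.simps)
  then have diff: "f differentiable_on UNIV" by auto
  have DERIV: "(f has_real_derivative frechet_derivative f (at x) 1) (at x)" for x
  proof -
    have D: "(f has_derivative frechet_derivative f (at x)) (at x)"
      by (rule has_derivative_frechet[OF diff])
    have "frechet_derivative f (at x) h = frechet_derivative f (at x) 1 * h" for h
      using linear_scale[OF has_derivative_linear[OF D], of h 1] by simp
    then have "frechet_derivative f (at x) = (*) (frechet_derivative f (at x) 1)"
      by blast
    with D show ?thesis by (simp only: has_field_derivative_def)
  qed
  then show "(f has_real_derivative deriv f x) (at x)"
    by (metis DERIV_imp_deriv)
  have "deriv f = (\<lambda>x. frechet_derivative f (at x) 1)"
    using DERIV DERIV_imp_deriv by blast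
  then show "smooth (deriv f)"
    using Suc by (simp add: smooth_def)
qed

lemma smooth_continuous: "smooth f \<Longrightarrow> continuous_on UNIV f"
  unfolding smooth_def by (metis times_cont_diff.simps(1))

section \<open>Bump functions and extension of test functions\<close>

definition flat_exp :: "nat \<Rightarrow> real \<Rightarrow> real" where
  "flat_exp n x = (if x \<le> 0 then 0 else exp (- (1 / x)) / x ^ n)"

text \<open>Substituting \<open>y = 1 / x\<close> turns the claim into the decay of
  \<open>y ^ n / exp y\<close> at infinity.\<close>

lemma flat_exp_tendsto_0: "(flat_exp n \<longlongrightarrow> 0) (at_right 0)"
proof -
  have "((\<lambda>x::real. exp (- (1 / x)) / x ^ n) \<longlongrightarrow> 0) (at_right 0)"
  proof -
    have "((\<lambda>y::real. y ^ n / exp y) \<longlongrightarrow> 0) at_top"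
      by (rule tendsto_power_div_exp_0)
    then have "((\<lambda>x::real. (inverse x) ^ n / exp (inverse x)) \<longlongrightarrow> 0) (at_right 0)"
      by (rule filterlim_compose) (rule filterlim_inverse_at_top_right)
    then show ?thesis by (simp add: field_simps exp_minus)
  qed
  then show ?thesis
    by (rule Lim_transform_eventually)
      (auto simp: flat_exp_def eventually_at_filter)
qed

text \<open>The derivative is again a linear combination of members of the family. This is why the
  power \<open>x ^ n\<close> is built into \<open>flat_exp\<close>: smoothness then follows by one
  induction with \<open>n\<close> arbitrary.\<close>

lemma flat_exp_derivative:
  "(flat_exp n has_real_derivative flat_exp (n + 2) x - real n * flat_exp (n + 1) x) (at x)"
proof -
  consider "x < 0" | "x = 0" | "x > 0" by linarith
  then show ?thesis
  proof cases
    case 1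
    have "(flat_exp n has_real_derivative 0) (at x)"
      by (rule has_field_derivative_transform_within_open[where f = "\<lambda>x. 0" and S = "{..<0}"])
        (use 1 in \<open>auto simp: flat_exp_def\<close>)
    then show ?thesis using 1 by (simp add: flat_exp_def)
  next
    case 2
    \<comment> \<open>For positive \<open>h\<close> the difference quotient at 0 is exactly
      \<open>flat_exp (Suc n) h\<close>.\<close>
    have r: "((\<lambda>h. flat_exp n h / h) \<longlongrightarrow> 0) (at_right 0)"
      by (rule Lim_transform_eventually[OF flat_exp_tendsto_0[of "Suc n"]])
        (auto simp: flat_exp_def eventually_at_filter)
    have l: "((\<lambda>h. flat_exp n h / h) \<longlongrightarrow> 0) (at_left 0)"
      by (rule Lim_transform_eventually[OF tendsto_const])
        (auto simp: flat_exp_def eventually_at_filter)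
    have "((\<lambda>h. flat_exp n h / h) \<longlongrightarrow> 0) (at 0)"
      using l r filterlim_split_at by blast
    then show ?thesis using 2 by (simp add: DERIV_def flat_exp_def)
  next
    case 3
    have "((\<lambda>x. exp (- (1 / x)) / x ^ n) has_real_derivative
        flat_exp (n + 2) x - real n * flat_exp (n + 1) x) (at x)"
      using 3 by (cases n) (auto intro!: derivative_eq_intros
          simp: flat_exp_def field_simps power_add power2_eq_square,
          metis One_nat_def Suc_pred neq0_conv power_Suc)
    then show ?thesis
      by (rule has_field_derivative_transform_within_open[where S = "{0<..}"])
        (use 3 in \<open>auto simp: flat_exp_def\<close>)
  qed
qed

lemma smooth_flat_exp: "smooth (flat_exp n)"
proof -
  have "times_cont_diff k (flat_exp n)" for k
  proof (induction k arbitrary: n)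
    case 0
    then show ?case
      using flat_exp_derivative by (auto intro!: DERIV_continuous_on)
  next
    case (Suc k)
    have "times_cont_diff k (\<lambda>x. flat_exp (n + 2) x + (- real n) * flat_exp (n + 1) x)"
      by (intro times_cont_diff_add times_cont_diff_mult times_cont_diff_const Suc)
    then show ?case
      by (intro times_cont_diff_Suc_real[OF flat_exp_derivative]) simp
  qed
  then show ?thesis by (simp add: smooth_def)
qed

text \<open>Inside the interval (-1, 1) this is exp (2 - 2 / (1 - x^2)); the factor
  \<open>exp 2\<close> normalises the value at 0 to 1.\<close>

definition bump :: "real \<Rightarrow> real" where
  "bump x = exp 2 * flat_exp 0 (1 - x) * flat_exp 0 (1 + x)"

lemma bump_0: "bump 0 = 1"
  by (simp add: bump_def flat_exp_def flip: exp_add)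

lemma bump_support: "bump x \<noteq> 0 \<Longrightarrow> \<bar>x\<bar> < 1"
  by (auto simp: bump_def flat_exp_def split: if_splits)

lemma smooth_bump: "smooth bump"
proof -
  have "smooth (\<lambda>x. exp 2 * flat_exp 0 (- x + 1) * flat_exp 0 (x + 1))"
    by (intro smooth_mult smooth_const smooth_affine smooth_flat_exp
        bounded_linear_minus bounded_linear_ident)
  then show ?thesis by (simp add: bump_def[abs_def] algebra_simps)
qed

lemma bump_derivative_0: "(bump has_real_derivative 0) (at 0)"
proof -
  \<comment> \<open>The two factors of \<open>bump\<close> are the cases \<open>s = -1\<close> and
    \<open>s = 1\<close>; their contributions to the product rule at 0 cancel.\<close>
  have D: "((\<lambda>x. flat_exp 0 (1 + s * x)) has_real_derivative flat_exp 2 1 * s) (at 0)" for s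
    by (rule DERIV_chain2[where f = "flat_exp 0"])
      (use flat_exp_derivative[of 0 1] in \<open>auto intro!: derivative_eq_intros simp: numeral_2_eq_2\<close>)
  show ?thesis
    unfolding bump_def[abs_def] using D[of "-1"] D[of 1]
    by (auto intro!: derivative_eq_intros)
qed

lemma sphere_phase_test_extension:
  assumes "\<phi> \<in> circle_phase_tests"
  shows "(\<lambda>(\<alpha>, \<theta>, a, w). bump (\<alpha> - pi / 2) * bump a * \<phi> (\<theta>, w)) \<in> sphere_phase_tests"
    (is "?\<Phi> \<in> _")
proof -
  obtain R where \<phi>: "smooth \<phi>" "\<And>\<theta> w. \<phi> (\<theta> + 2 * pi, w) = \<phi> (\<theta>, w)"
    and R: "\<And>\<theta> w. \<phi> (\<theta>, w) \<noteq> 0 \<Longrightarrow> \<bar>w\<bar> \<le> R"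
    using assms by (auto simp: circle_phase_tests_def)
  let ?L = "\<lambda>z::real \<times> real \<times> real \<times> real. (fst (snd z), snd (snd (snd z)))"
  \<comment> \<open>Written with linear projections and constant shifts, so that closure under
    products and affine substitutions suffices.\<close>
  have "smooth (\<lambda>z::real \<times> real \<times> real \<times> real.
      bump (fst z + (- (pi / 2))) * bump (fst (snd (snd z)) + 0) * \<phi> (?L z + 0))"
    by (intro smooth_mult smooth_affine[where L = ?L] smooth_affine[where L = fst]
        smooth_affine[where L = "\<lambda>z. fst (snd (snd z))"] smooth_bump \<phi>
        bounded_linear_Pair bounded_linear_fst_comp bounded_linear_snd_comp
        bounded_linear_fst bounded_linear_snd)
  then have "smooth ?\<Phi>"
    by (simp add: case_prod_unfold)
  moreover have "\<exists>\<epsilon>>0. \<exists>R. \<forall>\<alpha> \<theta> a w. ?\<Phi> (\<alpha>, \<theta>, a, w) \<noteq> 0 \<longrightarrow>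
      \<epsilon> \<le> \<alpha> \<and> \<alpha> \<le> pi - \<epsilon> \<and> \<bar>a\<bar> \<le> R \<and> \<bar>w\<bar> \<le> R"
  \<comment> \<open>The bump in \<alpha> has radius 1 around pi / 2, which leaves a margin of
    \<open>pi / 2 - 1\<close> before either pole.\<close>
  proof (rule exI[of _ "pi / 2 - 1"], intro conjI exI[of _ "max 1 R"] allI impI)
    show "pi / 2 - 1 > 0" using pi_gt3 by simp
  next
    fix \<alpha> \<theta> a w :: real
    assume "?\<Phi> (\<alpha>, \<theta>, a, w) \<noteq> 0"
    then have *: "\<bar>\<alpha> - pi / 2\<bar> < 1" "\<bar>a\<bar> < 1" "\<bar>w\<bar> \<le> R"
      using bump_support R by auto
    show "pi / 2 - 1 \<le> \<alpha>" "\<alpha> \<le> pi - (pi / 2 - 1)" using *(1) by (auto simp: abs_if split: if_splits)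
    show "\<bar>a\<bar> \<le> max 1 R" "\<bar>w\<bar> \<le> max 1 R" using * by auto
  qed
  ultimately show ?thesis
    using \<phi>(2) unfolding sphere_phase_tests_def by simp
qed


section \<open>Periodic functions\<close>

lemma periodic_int:
  fixes p :: "real \<Rightarrow> 'a"
  assumes "\<And>x. p (x + T) = p x"
  shows "p (x + T * of_int k) = p x"
proof -
  have nat: "p (x + T * of_nat n) = p x" for n x
  proof (induction n)
    case (Suc n)
    have "p (x + T * of_nat (Suc n)) = p ((x + T * of_nat n) + T)"
      by (simp add: algebra_simps)
    then show ?case using assms Suc by simp
  qed simp
  show ?thesis
  proof (cases "k \<ge> 0")
    case True
    then show ?thesis using nat[of x "nat k"] by simp
  next
    case False
    then show ?thesis using nat[of "x + T * of_int k" "nat (- k)"] by simp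
  qed
qed

lemma period_shift:
  fixes x :: real
  assumes "T > 0"
  obtains k where "x + T * of_int k \<in> {0..<T}"
proof
  have "x + T * of_int (- \<lfloor>x / T\<rfloor>) = T * frac (x / T)"
    using assms by (simp add: frac_def algebra_simps)
  then show "x + T * of_int (- \<lfloor>x / T\<rfloor>) \<in> {0..<T}"
    using assms frac_lt_1[of "x / T"] by simp
qed

lemma periodic_bounded:
  fixes p :: "real \<Rightarrow> real"
  assumes "\<And>x. p (x + T) = p x" "T > 0" "continuous_on UNIV p"
  obtains C where "\<And>x. \<bar>p x\<bar> \<le> C"
proof -
  have "compact (p ` {0..T})"
    using assms(3) by (intro compact_continuous_image) (auto intro: continuous_on_subset)
  then obtain C where C: "\<forall>x\<in>{0..T}. \<bar>p x\<bar> \<le> C"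
    using compact_imp_bounded[of "p ` {0..T}"] by (auto simp: bounded_iff simp del: atLeastAtMost_iff)
  have "\<bar>p x\<bar> \<le> C" for x
  proof -
    obtain k where "x + T * of_int k \<in> {0..<T}" using period_shift[OF assms(2)] .
    then show ?thesis using C[rule_format, of "x + T * of_int k"] periodic_int[of p T x k] assms(1) by simp
  qed
  then show thesis using that by blast
qed

text \<open>Reduce \<open>c\<close> modulo \<open>T\<close> to \<open>d\<close> in [0, T), cut the
  period at \<open>d\<close>, move the left piece one period to the right, and translate the
  resulting interval back by \<open>d\<close>. Using \<open>has_bochner_integral\<close> gives
  integrability and value together.\<close>

lemma has_integral_periodic_shift:
  fixes p :: "real \<Rightarrow> real"
  assumes per: "\<And>x. p (x + T) = p x" and T: "T > 0"
    and int: "set_integrable lborel {0..<T} p"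
  shows "has_bochner_integral lborel (\<lambda>x. indicator {0..<T} x *\<^sub>R p (x + c)) (LBINT x:{0..<T}. p x)"
proof -
  obtain k where k: "c + T * of_int k \<in> {0..<T}" using period_shift[OF T] .
  define d where "d = c + T * of_int k"
  have d: "0 \<le> d" "d < T" using k by (auto simp: d_def)
  have int1: "set_integrable lborel {0..<d} p" and int2: "set_integrable lborel {d..<T} p"
    by (rule set_integrable_subset[OF int]; use d in auto)+
  have split: "(LBINT x:{0..<T}. p x) = (LBINT x:{0..<d}. p x) + (LBINT x:{d..<T}. p x)"
  proof -
    have "{0..<T} = {0..<d} \<union> {d..<T}" using d by auto
    then show ?thesis using set_integral_Un[OF _ int1 int2] by simp
  qed
  \<comment> \<open>The piece over [0, d) is carried to [T, T + d); periodicity leaves the integrand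
    unchanged.\<close>
  have "has_bochner_integral lborel (\<lambda>x. indicator {0..<d} (- T + 1 * x) *\<^sub>R p (- T + 1 * x))
      ((LBINT x:{0..<d}. p x) /\<^sub>R \<bar>1\<bar>)"
    by (subst lborel_has_bochner_integral_real_affine_iff[symmetric])
      (use int1 in \<open>auto simp: has_bochner_integral_iff set_integrable_def set_lebesgue_integral_def\<close>)
  moreover have "p (- T + x) = p x" for x using per[of "- T + x"] by simp
  ultimately have "has_bochner_integral lborel (\<lambda>x. indicator {0..<d} (x - T) *\<^sub>R p x)
      (LBINT x:{0..<d}. p x)" by simp
  moreover have "has_bochner_integral lborel (\<lambda>x. indicator {d..<T} x *\<^sub>R p x) (LBINT x:{d..<T}. p x)"
    using int2 by (auto simp: has_bochner_integral_iff set_integrable_def set_lebesgue_integral_def)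
  ultimately have "has_bochner_integral lborel
      (\<lambda>x. indicator {0..<d} (x - T) *\<^sub>R p x + indicator {d..<T} x *\<^sub>R p x) (LBINT x:{0..<T}. p x)"
    unfolding split by (rule has_bochner_integral_add)
  \<comment> \<open>The two pieces now cover [d, T + d), which the substitution by
    \<open>d + x\<close> brings back to [0, T).\<close>
  then have "has_bochner_integral lborel (\<lambda>x. indicator {0..<d} (d + 1 * x - T) *\<^sub>R p (d + 1 * x)
      + indicator {d..<T} (d + 1 * x) *\<^sub>R p (d + 1 * x)) ((LBINT x:{0..<T}. p x) /\<^sub>R \<bar>1\<bar>)"
    by (subst lborel_has_bochner_integral_real_affine_iff[of 1 _ _ d, symmetric]) auto
  moreover have "indicator {0..<d} (d + 1 * x - T) *\<^sub>R p (d + 1 * x)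
      + indicator {d..<T} (d + 1 * x) *\<^sub>R p (d + 1 * x) = indicator {0..<T} x *\<^sub>R p (x + c)" for x
  proof -
    have "p (d + x) = p (x + c)"
      using periodic_int[of p T "x + c" k] per by (simp add: d_def algebra_simps)
    then show ?thesis using d by (auto simp: indicator_def)
  qed
  ultimately show ?thesis by simp
qed

lemma set_integrable_periodic_shift:
  fixes p :: "real \<Rightarrow> real"
  assumes "\<And>x. p (x + T) = p x" "T > 0" "set_integrable lborel {0..<T} p"
  shows "set_integrable lborel {0..<T} (\<lambda>x. p (x + c))"
  using has_integral_periodic_shift[OF assms] by (simp add: has_bochner_integral_iff set_integrable_def)

lemma set_integral_periodic_shift:
  fixes p :: "real \<Rightarrow> real"
  assumes "\<And>x. p (x + T) = p x" "T > 0" "set_integrable lborel {0..<T} p"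
  shows "(LBINT x:{0..<T}. p (x + c)) = (LBINT x:{0..<T}. p x)"
  using has_integral_periodic_shift[OF assms]
  by (simp add: has_bochner_integral_iff set_lebesgue_integral_def)


section \<open>The kernel on the great circle\<close>

text \<open>An elementary form of Jordan's inequality. Up to pi / 3 the difference increases because
  the cosine is at least 1/2; beyond, the sine is at least \<open>sqrt 3 / 2\<close>.\<close>

lemma sin_ge_half:
  fixes y :: real
  assumes "0 \<le> y" "y \<le> pi / 2"
  shows "y / 2 \<le> sin y"
proof (cases "y \<le> pi / 3")
  case True
  have "sin 0 - 0 / 2 \<le> sin y - y / 2"
  proof (rule DERIV_nonneg_imp_nondecreasing[OF assms(1)])
    fix x assume x: "0 \<le> x" "x \<le> y"
    have "((\<lambda>x. sin x - x / 2) has_real_derivative cos x - 1 / 2) (at x)"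
      by (auto intro!: derivative_eq_intros)
    moreover have "cos (pi / 3) \<le> cos x"
      using x True by (intro cos_monotone_0_pi_le) auto
    ultimately show "\<exists>D. ((\<lambda>x. sin x - x / 2) has_real_derivative D) (at x) \<and> D \<ge> 0"
      by (auto simp: cos_60)
  qed
  then show ?thesis by simp
next
  case False
  have "sin (pi / 3) \<le> sin y"
    using False assms by (intro sin_monotone_2pi_le) auto
  \<comment> \<open>The number 1.6 separates pi / 2 from \<open>sqrt 3\<close>.\<close>
  moreover have "sqrt 3 \<ge> sqrt (1.6 ^ 2)"
    by (subst real_sqrt_le_iff) (simp add: power2_eq_square)
  then have "sqrt 3 \<ge> 1.6" by simp
  moreover have "y \<le> 1.6" using assms pi_less_4 pi_approx by simp
  ultimately show ?thesis by (simp add: sin_60)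
qed

text \<open>Trades a logarithmic singularity for an integrable power; it follows from
  \<open>ln u = 2 * ln (sqrt u)\<close>.\<close>

lemma ln_le_sqrt:
  fixes u :: real
  assumes "u > 0"
  shows "ln u \<le> 2 * sqrt u"
  using ln_le_minus_one[of "sqrt u"] assms by (simp add: ln_sqrt)

text \<open>The logarithm is singular at both ends: the cotangent blows up at 0 and vanishes at pi.
  Bounding the logarithms of \<open>cot (x / 2)\<close> and of its inverse by square roots treats
  the two ends separately, and the sum of the two bounds covers both signs.\<close>

lemma ln_cot_bound:
  assumes "0 < x" "x < pi"
  shows "\<bar>ln \<bar>cot (x / 2)\<bar>\<bar> \<le> 4 * (x powr (- 1 / 2) + (pi - x) powr (- 1 / 2))"
proof -
  have pos: "sin (x / 2) > 0" "cos (x / 2) > 0"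
    using assms by (auto intro!: sin_gt_zero cos_gt_zero)
  have sin: "sin (x / 2) \<ge> x / 4" using sin_ge_half[of "x / 2"] assms by simp
  have cos: "cos (x / 2) \<ge> (pi - x) / 4"
    using sin_ge_half[of "(pi - x) / 2"] assms by (simp add: sin_diff diff_divide_distrib)
  have sqrt: "2 * sqrt (4 / y) = 4 * y powr (- 1 / 2)" if "y > 0" for y :: real
    using that by (simp add: powr_minus powr_half_sqrt real_sqrt_divide field_simps)
  have "cot (x / 2) \<le> 1 / (x / 4)"
    unfolding cot_def using pos sin assms by (intro frac_le) auto
  then have "2 * sqrt (cot (x / 2)) \<le> 4 * x powr (- 1 / 2)"
    using sqrt[of x] assms real_sqrt_le_mono[of "cot (x / 2)" "4 / x"] by simp
  moreover have "inverse (cot (x / 2)) \<le> 1 / ((pi - x) / 4)"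
    unfolding cot_def inverse_divide using pos cos assms by (intro frac_le) auto
  then have "2 * sqrt (inverse (cot (x / 2))) \<le> 4 * (pi - x) powr (- 1 / 2)"
    using sqrt[of "pi - x"] assms real_sqrt_le_mono[of "inverse (cot (x / 2))" "4 / (pi - x)"] by simp
  moreover have cot: "cot (x / 2) > 0" using pos by (simp add: cot_def)
  moreover have "ln (cot (x / 2)) \<le> 2 * sqrt (cot (x / 2))"
    "- ln (cot (x / 2)) \<le> 2 * sqrt (inverse (cot (x / 2)))"
    using ln_le_sqrt[OF cot] ln_le_sqrt[of "inverse (cot (x / 2))"] cot by (simp_all add: ln_inverse)
  moreover have "0 \<le> x powr (- 1 / 2)" "0 \<le> (pi - x) powr (- 1 / 2)" by simp_all
  ultimately have "\<bar>ln (cot (x / 2))\<bar> \<le> 4 * (x powr (- 1 / 2) + (pi - x) powr (- 1 / 2))"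
    by argo
  then show ?thesis using cot by simp
qed

lemma W_measurable [measurable]: "W \<in> borel_measurable borel"
  unfolding W_def cot_def by measurable

lemma W_periodic: "W (x + 2 * pi) = W x"
  by (simp add: W_def cot_def add_divide_distrib)

text \<open>The half angle becomes \<open>pi - x / 2\<close>; the cotangent changes sign and the
  absolute value absorbs it.\<close>

lemma W_reflect: "W (2 * pi - x) = W x"
  by (simp add: W_def cot_def diff_divide_distrib sin_diff cos_diff)

lemma set_integrable_powr_minus_half:
  "set_integrable lborel {0..pi} (\<lambda>x. x powr (- 1 / 2))"
proof -
  have "(\<lambda>x. x powr (- 1 / 2)) absolutely_integrable_on {0..pi}"
    by (intro nonnegative_absolutely_integrable_1 integrable_on_powr_from_0) auto
  \<comment> \<open>Absolute integrability refers to the completed Lebesgue measure; for a Borel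
    function this agrees with \<open>lborel\<close>.\<close>
  then show ?thesis
    unfolding set_integrable_def by (subst (asm) integrable_completion) auto
qed

lemma set_integrable_reflect:
  fixes f :: "real \<Rightarrow> real"
  assumes "set_integrable lborel A f"
  shows "set_integrable lborel ((\<lambda>x. c - x) -` A) (\<lambda>x. f (c - x))"
  using lborel_integrable_real_affine[OF assms[unfolded set_integrable_def], of "-1" c]
  by (simp add: set_integrable_def indicator_vimage[unfolded comp_def])

text \<open>Domination by the power bound handles (0, pi), and reflection carries this to (pi, 2
  pi). Only the null points 0 and pi remain.\<close>

lemma set_integrable_W: "set_integrable lborel {0..<2 * pi} W"
proof -
  let ?h = "\<lambda>x. x powr (- 1 / 2)"
  have "(\<lambda>x. pi - x) -` {0..pi} = {0..pi}" by auto
  then have "set_integrable lborel {0..pi} (\<lambda>x. ?h (pi - x))"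
    using set_integrable_reflect[OF set_integrable_powr_minus_half, of pi] by simp
  then have "set_integrable lborel {0..pi} (\<lambda>x. 1 / (2 * pi) * (4 * (?h x + ?h (pi - x))))"
    using set_integrable_powr_minus_half by (intro set_integrable_mult_right set_integral_add)
  then have int: "set_integrable lborel {0<..<pi} (\<lambda>x. 1 / (2 * pi) * (4 * (?h x + ?h (pi - x))))"
    by (rule set_integrable_subset) auto
  have left: "set_integrable lborel {0<..<pi} W"
  proof (rule set_integrable_bound[OF int])
    show "set_borel_measurable lborel {0<..<pi} W"
      by (simp add: set_borel_measurable_def)
    have "norm (W x) \<le> norm (1 / (2 * pi) * (4 * (?h x + ?h (pi - x))))" if "0 < x" "x < pi" for x
      using ln_cot_bound[OF that] by (simp add: W_def abs_mult divide_right_mono)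
    then show "AE x in lborel. x \<in> {0<..<pi} \<longrightarrow>
        norm (W x) \<le> norm (1 / (2 * pi) * (4 * (?h x + ?h (pi - x))))"
      by (intro AE_I2) simp
  qed
  have "(\<lambda>x. 2 * pi - x) -` {0<..<pi} = {pi<..<2 * pi}" by auto
  then have "set_integrable lborel {pi<..<2 * pi} W"
    using set_integrable_reflect[OF left, of "2 * pi"] by (simp add: W_reflect)
  with left have int2: "set_integrable lborel ({0<..<pi} \<union> {pi<..<2 * pi}) W"
    by (intro set_integrable_Un) auto
  have "AE x in lborel. x \<noteq> (0::real)" "AE x in lborel. x \<noteq> pi"
    by (rule AE_lborel_singleton)+
  then have "AE x in lborel. indicator ({0<..<pi} \<union> {pi<..<2 * pi}) x *\<^sub>R W x
      = indicator {0..<2 * pi} x *\<^sub>R W x"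
    by eventually_elim (auto simp: indicator_def)
  from integrable_cong_AE[THEN iffD1, OF _ _ this] int2 show ?thesis
    unfolding set_integrable_def by simp
qed


section \<open>Convolution with test functions\<close>

lemma circle_testsD:
  assumes "\<psi> \<in> circle_tests"
  shows "smooth \<psi>" "\<psi> (\<theta> + 2 * pi) = \<psi> \<theta>"
  using assms by (auto simp: circle_tests_def)

lemma deriv_circle_test:
  assumes "\<psi> \<in> circle_tests"
  shows "deriv \<psi> \<in> circle_tests"
proof -
  note \<psi> = circle_testsD[OF assms]
  have "deriv \<psi> (\<theta> + 2 * pi) = deriv \<psi> \<theta>" for \<theta>
  proof -
    have "((\<lambda>x. \<psi> (x + 2 * pi)) has_real_derivative deriv \<psi> (\<theta> + 2 * pi)) (at \<theta>)"
      using smooth_real_derivative(1)[OF \<psi>(1), of "\<theta> + 2 * pi"] by (simp add: DERIV_shift)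
    then show ?thesis
      using DERIV_unique smooth_real_derivative(1)[OF \<psi>(1), of \<theta>] by (simp add: \<psi>(2))
  qed
  then show ?thesis
    using smooth_real_derivative(2)[OF \<psi>(1)] by (simp add: circle_tests_def)
qed

lemma circle_test_bounded:
  assumes "\<psi> \<in> circle_tests"
  obtains C where "\<And>\<theta>. \<bar>\<psi> \<theta>\<bar> \<le> C"
  using periodic_bounded[of \<psi> "2 * pi"] circle_testsD[OF assms] smooth_continuous by auto

lemma circle_test_measurable:
  "\<psi> \<in> circle_tests \<Longrightarrow> \<psi> \<in> borel_measurable borel"
  using circle_testsD smooth_continuous by (blast intro: borel_measurable_continuous_onI)

lemma set_integrable_mult_bounded:
  fixes u \<psi> :: "real \<Rightarrow> real"
  assumes u: "set_integrable lborel S u" and \<psi>: "\<psi> \<in> borel_measurable borel" "\<And>x. \<bar>\<psi> x\<bar> \<le> C"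
  shows "set_integrable lborel S (\<lambda>x. u x * \<psi> x)"
proof -
  have "integrable lborel (\<lambda>x. (indicator S x *\<^sub>R u x) * \<psi> x)"
  proof (rule Bochner_Integration.integrable_bound)
    show "integrable lborel (\<lambda>x. C *\<^sub>R (indicator S x *\<^sub>R u x))"
      using u by (intro integrable_scaleR_right) (simp add: set_integrable_def)
    show "(\<lambda>x. (indicator S x *\<^sub>R u x) * \<psi> x) \<in> borel_measurable lborel"
      using u \<psi>(1) by (intro borel_measurable_times) (auto simp: set_integrable_def)
    have "\<bar>indicator S x * u x * \<psi> x\<bar> \<le> \<bar>C * (indicator S x * u x)\<bar>" for x
      using mult_mono[OF order_refl[of "\<bar>indicator S x * u x\<bar>"] order_trans[OF \<psi>(2)[of x] abs_ge_self[of C]]]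
      by (simp add: abs_mult mult_ac)
    then show "AE x in lborel. norm ((indicator S x *\<^sub>R u x) * \<psi> x) \<le> norm (C *\<^sub>R (indicator S x *\<^sub>R u x))"
      by simp
  qed
  then show ?thesis by (simp add: set_integrable_def mult_ac)
qed

text \<open>Two uses of the mean value inequality: first for \<open>\<psi>'\<close>, then for \<psi>
  minus its linear part on the ball of radius \<open>\<bar>h\<bar>\<close>.\<close>

lemma first_order_Taylor_bound:
  fixes \<psi> :: "real \<Rightarrow> real"
  assumes D: "\<And>x. (\<psi> has_real_derivative \<psi>' x) (at x)" "\<And>x. (\<psi>' has_real_derivative \<psi>'' x) (at x)"
    and C: "\<And>x. \<bar>\<psi>'' x\<bar> \<le> C"
  shows "\<bar>\<psi> (y + h) - \<psi> y - h * \<psi>' y\<bar> \<le> C * h\<^sup>2"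
proof -
  have C0: "0 \<le> C" using C[of 0] by simp
  have lip: "\<bar>\<psi>' u - \<psi>' y\<bar> \<le> C * \<bar>u - y\<bar>" for u
    using field_differentiable_bound[of UNIV \<psi>' \<psi>'' C u y] D(2) C by simp
  have "norm ((\<psi> (y + h) - (y + h) * \<psi>' y) - (\<psi> y - y * \<psi>' y)) \<le> C * \<bar>h\<bar> * norm ((y + h) - y)"
  proof (rule field_differentiable_bound[of "cball y \<bar>h\<bar>" _ "\<lambda>u. \<psi>' u - \<psi>' y"])
    fix u assume u: "u \<in> cball y \<bar>h\<bar>"
    show "((\<lambda>u. \<psi> u - u * \<psi>' y) has_field_derivative \<psi>' u - \<psi>' y) (at u within cball y \<bar>h\<bar>)"
      by (auto intro!: derivative_eq_intros has_field_derivative_at_within[OF D(1)])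
    have "C * \<bar>u - y\<bar> \<le> C * \<bar>h\<bar>"
      using u C0 by (intro mult_left_mono) (auto simp: dist_real_def)
    then show "norm (\<psi>' u - \<psi>' y) \<le> C * \<bar>h\<bar>"
      using lip[of u] by simp
  qed (auto simp: dist_real_def)
  then have "\<bar>\<psi> (y + h) - \<psi> y - h * \<psi>' y\<bar> \<le> C * (\<bar>h\<bar> * \<bar>h\<bar>)"
    by (simp add: algebra_simps)
  then show ?thesis by (simp only: abs_mult_self_eq power2_eq_square)
qed

context
  fixes K :: "real \<Rightarrow> real"
  assumes K_meas [measurable]: "K \<in> borel_measurable borel"
    and K_per: "\<And>x. K (x + 2 * pi) = K x"
    and K_int: "set_integrable lborel {0..<2 * pi} K"
begin

text \<open>Periodicity moves the parameter \<open>x\<close> from the singular kernel to the smooth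
  test function, where it can be differentiated.\<close>

lemma convolution_shift:
  assumes \<psi>: "\<psi> \<in> circle_tests"
  shows "set_integrable lborel {0..<2 * pi} (\<lambda>s. K s * \<psi> (s + x))"
    and "(LBINT \<theta>:{0..<2 * pi}. K (\<theta> - x) * \<psi> \<theta>) = (LBINT s:{0..<2 * pi}. K s * \<psi> (s + x))"
proof -
  obtain C where C: "\<And>\<theta>. \<bar>\<psi> \<theta>\<bar> \<le> C" using circle_test_bounded[OF \<psi>] by blast
  note [measurable] = circle_test_measurable[OF \<psi>]
  show int: "set_integrable lborel {0..<2 * pi} (\<lambda>s. K s * \<psi> (s + x))"
    by (rule set_integrable_mult_bounded[OF K_int _ C]) measurable
  have "K (s + 2 * pi) * \<psi> (s + 2 * pi + x) = K s * \<psi> (s + x)" for s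
    using circle_testsD(2)[OF \<psi>, of "s + x"] K_per[of s] by (simp add: algebra_simps)
  from set_integral_periodic_shift[OF this _ int, of "- x"]
  show "(LBINT \<theta>:{0..<2 * pi}. K (\<theta> - x) * \<psi> \<theta>) = (LBINT s:{0..<2 * pi}. K s * \<psi> (s + x))"
    by simp
qed

text \<open>The Taylor remainder of the test function is bounded uniformly in the base point.
  Integrating it against the kernel gives an error of at most \<open>C * M * h\<^sup>2\<close>, with
  \<open>M\<close> the L1 norm of \<open>K\<close> over one period.\<close>

lemma convolution_derivative:
  assumes \<psi>: "\<psi> \<in> circle_tests"
  shows "((\<lambda>x. LBINT \<theta>:{0..<2 * pi}. K (\<theta> - x) * \<psi> \<theta>) has_real_derivative
           (LBINT \<theta>:{0..<2 * pi}. K (\<theta> - x) * deriv \<psi> \<theta>)) (at x)"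
proof -
  note \<psi>' = deriv_circle_test[OF \<psi>]
  obtain C where C: "\<And>\<theta>. \<bar>deriv (deriv \<psi>) \<theta>\<bar> \<le> C"
    using circle_test_bounded[OF deriv_circle_test[OF \<psi>']] by blast
  have Taylor: "\<bar>\<psi> (y + h) - \<psi> y - h * deriv \<psi> y\<bar> \<le> C * h\<^sup>2" for y h
    by (rule first_order_Taylor_bound[where \<psi>'' = "deriv (deriv \<psi>)", OF _ _ C])
      (intro smooth_real_derivative(1) circle_testsD(1) \<psi> \<psi>')+
  define J where "J \<eta> x = (LBINT s:{0..<2 * pi}. K s * \<eta> (s + x))" for \<eta> :: "real \<Rightarrow> real" and x
  define M where "M = (LBINT s:{0..<2 * pi}. \<bar>K s\<bar>)"
  have bound: "\<bar>J \<psi> (x + h) - J \<psi> x - h * J (deriv \<psi>) x\<bar> \<le> C * M * h\<^sup>2" for h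
  proof -
    note int = convolution_shift(1)[OF \<psi>] convolution_shift(1)[OF \<psi>']
    define R where "R s = K s * \<psi> (s + (x + h)) - K s * \<psi> (s + x) - h * (K s * deriv \<psi> (s + x))" for s
    have R: "set_integrable lborel {0..<2 * pi} R"
      unfolding R_def by (intro set_integral_diff set_integrable_mult_right int)
    have R_bound: "\<bar>R s\<bar> \<le> C * h\<^sup>2 * \<bar>K s\<bar>" for s
    proof -
      have "R s = K s * (\<psi> ((s + x) + h) - \<psi> (s + x) - h * deriv \<psi> (s + x))"
        by (simp add: R_def algebra_simps)
      then show ?thesis
        using mult_left_mono[OF Taylor[of "s + x" h], of "\<bar>K s\<bar>"] by (simp add: abs_mult mult_ac)
    qed
    have "J \<psi> (x + h) - J \<psi> x - h * J (deriv \<psi>) x = (LBINT s:{0..<2 * pi}. R s)"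
      unfolding J_def R_def
      by (simp add: set_integral_diff set_integrable_mult_right int)
    moreover have "\<bar>LBINT s:{0..<2 * pi}. R s\<bar> \<le> (LBINT s:{0..<2 * pi}. \<bar>R s\<bar>)"
      using set_integral_norm_bound[OF R] by simp
    moreover have "(LBINT s:{0..<2 * pi}. \<bar>R s\<bar>) \<le> (LBINT s:{0..<2 * pi}. C * h\<^sup>2 * \<bar>K s\<bar>)"
      by (intro set_integral_mono set_integrable_mult_right set_integrable_abs R K_int R_bound)
    moreover have "(LBINT s:{0..<2 * pi}. C * h\<^sup>2 * \<bar>K s\<bar>) = C * M * h\<^sup>2"
      by (simp add: M_def mult_ac)
    ultimately show ?thesis by linarith
  qed
  have "(J \<psi> has_real_derivative J (deriv \<psi>) x) (at x)"
    unfolding DERIV_def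
  proof (rule LIM_zero_cancel, rule tendsto_rabs_zero_cancel, rule tendsto_sandwich)
    show "\<forall>\<^sub>F h in at 0. 0 \<le> \<bar>(J \<psi> (x + h) - J \<psi> x) / h - J (deriv \<psi>) x\<bar>" by simp
    have "\<bar>(J \<psi> (x + h) - J \<psi> x) / h - J (deriv \<psi>) x\<bar> \<le> C * M * \<bar>h\<bar>" if "h \<noteq> 0" for h
    proof -
      have "(J \<psi> (x + h) - J \<psi> x) / h - J (deriv \<psi>) x = (J \<psi> (x + h) - J \<psi> x - h * J (deriv \<psi>) x) / h"
        using that by (simp add: diff_divide_distrib)
      then have "\<bar>(J \<psi> (x + h) - J \<psi> x) / h - J (deriv \<psi>) x\<bar> * \<bar>h\<bar> = \<bar>J \<psi> (x + h) - J \<psi> x - h * J (deriv \<psi>) x\<bar>"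
        using that by (simp add: abs_divide)
      also have "\<dots> \<le> C * M * \<bar>h\<bar> * \<bar>h\<bar>"
        using bound[of h] by (simp add: power2_eq_square)
      finally show ?thesis using that by simp
    qed
    then show "\<forall>\<^sub>F h in at 0. \<bar>(J \<psi> (x + h) - J \<psi> x) / h - J (deriv \<psi>) x\<bar> \<le> C * M * \<bar>h\<bar>"
      by (auto simp: eventually_at_filter)
    show "((\<lambda>h. C * M * \<bar>h\<bar>) \<longlongrightarrow> 0) (at 0)"
      by (auto intro!: tendsto_eq_intros)
  qed auto
  then show ?thesis
    using convolution_shift(2)[OF \<psi>] convolution_shift(2)[OF \<psi>'] by (simp add: J_def[abs_def])
qed

text \<open>Fubini's theorem applies because \<open>K (\<theta> - x)\<close> has the same L1 norm in
  \<theta> over a period for every \<open>x\<close>, while \<rho> is integrable and \<psi>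
  bounded.\<close>

lemma convolution_duality:
  assumes \<rho>: "set_integrable lborel {0..<2 * pi} \<rho>" and \<psi>: "\<psi> \<in> circle_tests"
  shows "(LBINT x:{0..<2 * pi}. \<rho> x * (LBINT \<theta>:{0..<2 * pi}. K (\<theta> - x) * \<psi> \<theta>))
       = (LBINT \<theta>:{0..<2 * pi}. (LBINT x:{0..<2 * pi}. K (\<theta> - x) * \<rho> x) * \<psi> \<theta>)"
proof -
  let ?S = "{0..<2 * pi}"
  define r where "r x = indicator ?S x * \<rho> x" for x
  have r: "integrable lborel r" using \<rho> by (simp add: r_def[abs_def] set_integrable_def)
  then have [measurable]: "r \<in> borel_measurable borel" by auto
  note [measurable] = circle_test_measurable[OF \<psi>]
  obtain C where C: "\<And>\<theta>. \<bar>\<psi> \<theta>\<bar> \<le> C" using circle_test_bounded[OF \<psi>] by blast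
  \<comment> \<open>Both cutoffs are put into the integrand, so that Fubini's theorem can be used on
    the whole plane.\<close>
  define h where "h x \<theta> = r x * (indicator ?S \<theta> * (K (\<theta> - x) * \<psi> \<theta>))" for x \<theta>
  have shift: "set_integrable lborel ?S (\<lambda>\<theta>. K (\<theta> - x))" for x
    using set_integrable_periodic_shift[OF K_per _ K_int, of "- x"] by simp
  have inner: "set_integrable lborel ?S (\<lambda>\<theta>. K (\<theta> - x) * \<psi> \<theta>)" for x
    by (rule set_integrable_mult_bounded[OF shift _ C]) measurable
  define M where "M = (LBINT \<theta>:?S. \<bar>K \<theta>\<bar>)"
  have absK: "(LBINT \<theta>:?S. \<bar>K (\<theta> - x)\<bar>) = M" for x
    using set_integral_periodic_shift[of "\<lambda>\<theta>. \<bar>K \<theta>\<bar>" "2 * pi" "- x"] K_per set_integrable_abs[OF K_int]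
    by (simp add: M_def)
  have h_meas: "case_prod h \<in> borel_measurable (lborel \<Otimes>\<^sub>M lborel)"
    unfolding h_def by measurable
  have h_int: "integrable lborel (\<lambda>\<theta>. h x \<theta>)" for x
    using inner[of x] unfolding h_def set_integrable_def by simp
  have "integrable (lborel \<Otimes>\<^sub>M lborel) (case_prod h)"
  proof (rule lborel_pair.Fubini_integrable[OF h_meas])
    show "integrable lborel (\<lambda>x. \<integral>\<theta>. norm (case_prod h (x, \<theta>)) \<partial>lborel)"
    proof (rule Bochner_Integration.integrable_bound[of _ "\<lambda>x. r x * (M * C)"])
      show "integrable lborel (\<lambda>x. r x * (M * C))" using r by simp
      show "(\<lambda>x. \<integral>\<theta>. norm (case_prod h (x, \<theta>)) \<partial>lborel) \<in> borel_measurable lborel"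
        using h_meas by measurable
      have "(\<integral>\<theta>. \<bar>h x \<theta>\<bar> \<partial>lborel) \<le> \<bar>r x * (M * C)\<bar>" for x
      proof -
        have "(\<integral>\<theta>. \<bar>h x \<theta>\<bar> \<partial>lborel) = \<bar>r x\<bar> * (LBINT \<theta>:?S. \<bar>K (\<theta> - x) * \<psi> \<theta>\<bar>)"
          unfolding h_def set_lebesgue_integral_def by (simp add: abs_mult)
        also have "\<dots> \<le> \<bar>r x\<bar> * (LBINT \<theta>:?S. \<bar>K (\<theta> - x)\<bar> * C)"
          by (intro mult_left_mono set_integral_mono set_integrable_abs inner
              set_integrable_mult_left shift) (auto simp: abs_mult intro: mult_left_mono C)
        also have "\<dots> = \<bar>r x\<bar> * (M * C)" by (simp add: absK)
        also have "\<dots> \<le> \<bar>r x * (M * C)\<bar>" 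
          by (simp only: abs_mult[of "r x"]) (intro mult_left_mono abs_ge_self abs_ge_zero)
        finally show ?thesis .
      qed
      then show "AE x in lborel. norm (\<integral>\<theta>. norm (case_prod h (x, \<theta>)) \<partial>lborel) \<le> norm (r x * (M * C))"
        by simp
    qed
  qed (use h_int in simp)
  from lborel_pair.Fubini_integral[OF this]
  have "(\<integral>x. \<integral>\<theta>. h x \<theta> \<partial>lborel \<partial>lborel) = (\<integral>\<theta>. \<integral>x. h x \<theta> \<partial>lborel \<partial>lborel)" by simp
  moreover have "(\<integral>\<theta>. h x \<theta> \<partial>lborel) = indicator ?S x *\<^sub>R (\<rho> x * (LBINT \<theta>:?S. K (\<theta> - x) * \<psi> \<theta>))" for x
    by (simp add: h_def r_def set_lebesgue_integral_def)
  moreover have "(\<integral>x. h x \<theta> \<partial>lborel) = indicator ?S \<theta> *\<^sub>R ((LBINT x:?S. K (\<theta> - x) * \<rho> x) * \<psi> \<theta>)" for \<theta>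
  proof -
    have "h x \<theta> = (indicator ?S x *\<^sub>R (K (\<theta> - x) * \<rho> x)) * (indicator ?S \<theta> * \<psi> \<theta>)" for x
      by (simp add: h_def r_def)
    then show ?thesis by (simp add: set_lebesgue_integral_def)
  qed
  ultimately show ?thesis by (simp add: set_lebesgue_integral_def)
qed

end

text \<open>The definitions place the derivative on the convolved test function. It passes on to
  \<psi>, and duality then moves the convolution to \<rho>, giving the derivative of
  \<open>W\<close> convolved with \<rho>.\<close>

lemma circle_conv_dist_deriv:
  assumes "set_integrable lborel {0..<2 * pi} \<rho>" and \<psi>: "\<psi> \<in> circle_tests"
  shows "circle_conv W (dist_deriv (dist_of_fun \<rho>)) \<psi>
       = dist_deriv (dist_of_fun (\<lambda>\<theta>. LBINT x:{0..<2 * pi}. W (\<theta> - x) * \<rho> x)) \<psi>"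
proof -
  have "deriv (\<lambda>x. LBINT \<theta>:{0..<2 * pi}. W (\<theta> - x) * \<psi> \<theta>)
      = (\<lambda>x. LBINT \<theta>:{0..<2 * pi}. W (\<theta> - x) * deriv \<psi> \<theta>)"
    using convolution_derivative[OF W_measurable W_periodic set_integrable_W \<psi>] DERIV_imp_deriv by blast
  then show ?thesis
    using convolution_duality[OF W_measurable W_periodic set_integrable_W assms(1) deriv_circle_test[OF \<psi>]]
    by (simp add: circle_conv_def dist_deriv_def dist_of_fun_def)
qed


section \<open>States on the great circle\<close>

text \<open>Integrating slices against the Dirac mass leaves the slice at \<open>x\<close>. This
  turns the nested product in \<open>great_circle_state\<close> into a push-forward.\<close>

lemma pair_measure_return:
  assumes x: "x \<in> space N" and M: "sigma_finite_measure M"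
  shows "return N x \<Otimes>\<^sub>M M = distr M (N \<Otimes>\<^sub>M M) (Pair x)"
proof (rule measure_eqI)
  show "sets (return N x \<Otimes>\<^sub>M M) = sets (distr M (N \<Otimes>\<^sub>M M) (Pair x))"
    by (simp cong: sets_pair_measure_cong)
  fix A assume A: "A \<in> sets (return N x \<Otimes>\<^sub>M M)"
  then have A': "A \<in> sets (N \<Otimes>\<^sub>M M)" by (simp cong: sets_pair_measure_cong)
  have "emeasure (return N x \<Otimes>\<^sub>M M) A = (\<integral>\<^sup>+ y. emeasure M (Pair y -` A) \<partial>return N x)"
    by (rule sigma_finite_measure.emeasure_pair_measure_alt[OF M A])
  also have "\<dots> = emeasure M (Pair x -` A)"
    using x sigma_finite_measure.measurable_emeasure_Pair[OF M A'] by (rule nn_integral_return)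
  also have "Pair x -` A = Pair x -` A \<inter> space M"
    using sets.sets_into_space[OF A'] by (auto simp: space_pair_measure)
  also have "emeasure M \<dots> = emeasure (distr M (N \<Otimes>\<^sub>M M) (Pair x)) A"
    using A' x by (subst emeasure_distr) auto
  finally show "emeasure (return N x \<Otimes>\<^sub>M M) A = emeasure (distr M (N \<Otimes>\<^sub>M M) (Pair x)) A" .
qed

text \<open>The cutoff stands inside \<open>ennreal\<close> because a circle distribution function
  is assumed nonnegative only for angles in one period.\<close>

definition circle_state :: "(real \<Rightarrow> real \<Rightarrow> real) \<Rightarrow> (real \<times> real) measure" where
  "circle_state g = density lborel (\<lambda>z. ennreal (indicator ({0..<2 * pi} \<times> UNIV) z * g (fst z) (snd z)))"

lemma sets_circle_state [measurable_cong]: "sets (circle_state g) = sets borel"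
  by (simp add: circle_state_def)

lemma great_circle_measurable [measurable]:
  "(\<lambda>z::real \<times> real. (pi / 2, fst z, 0::real, snd z)) \<in> borel_measurable borel"
  by (intro borel_measurable_continuous_onI continuous_intros)

context
  fixes g :: "real \<Rightarrow> real \<Rightarrow> real"
  assumes g: "circle_distribution_function g"
begin

lemma circle_distribution_integrable:
  "integrable lborel (\<lambda>z. indicator ({0..<2 * pi} \<times> UNIV) z * g (fst z) (snd z))"
  using g by (simp add: circle_distribution_function_def set_integrable_def case_prod_unfold)

lemma circle_distribution_measurable [measurable]:
  "(\<lambda>z. indicator ({0..<2 * pi} \<times> UNIV) z * g (fst z) (snd z)) \<in> borel_measurable borel"
  using circle_distribution_integrable by auto

lemma circle_distribution_nonneg:
  "0 \<le> indicator ({0..<2 * pi} \<times> UNIV) z * g (fst z) (snd z)"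
  using g by (cases z) (auto simp: circle_distribution_function_def indicator_def)

lemma integrable_circle_state:
  fixes H :: "real \<times> real \<Rightarrow> real"
  assumes "H \<in> borel_measurable borel"
  shows "integrable (circle_state g) H \<longleftrightarrow>
           set_integrable lborel ({0..<2 * pi} \<times> UNIV) (\<lambda>z. g (fst z) (snd z) * H z)"
  unfolding circle_state_def set_integrable_def
  by (subst integrable_density) (simp_all add: assms circle_distribution_nonneg mult.assoc)

lemma integral_circle_state:
  fixes H :: "real \<times> real \<Rightarrow> real"
  assumes "H \<in> borel_measurable borel"
  shows "(\<integral>z. H z \<partial>circle_state g) = circle_pairing g H"
  unfolding circle_state_def circle_pairing_def set_lebesgue_integral_def
  by (subst integral_density) (simp_all add: assms circle_distribution_nonneg mult.assoc)

lemma finite_circle_state: "finite_measure (circle_state g)"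
proof
  have "emeasure (circle_state g) (space (circle_state g))
      = (\<integral>\<^sup>+ z. ennreal (indicator ({0..<2 * pi} \<times> UNIV) z * g (fst z) (snd z)) \<partial>lborel)"
    by (simp add: circle_state_def emeasure_density)
  also have "\<dots> < \<infinity>"
    using circle_distribution_integrable circle_distribution_nonneg
    by (subst nn_integral_eq_integral) auto
  finally show "emeasure (circle_state g) (space (circle_state g)) \<noteq> \<infinity>" by simp
qed

text \<open>The weight \<open>1 / (sin \<alpha>)\<^sup>2\<close> is 1 at the Dirac mass, and each
  Dirac factor becomes a constant coordinate of the embedding.\<close>

lemma great_circle_state_eq:
  "great_circle_state g = distr (circle_state g) borel (\<lambda>z. (pi / 2, fst z, 0, snd z))"
proof -
  have "density (return borel (pi / 2)) (\<lambda>\<alpha>. ennreal (1 / (sin \<alpha>)\<^sup>2)) = density (return borel (pi / 2)) (\<lambda>_. 1)"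
    by (rule density_cong) (auto simp: AE_return)
  then have a: "density (return borel (pi / 2)) (\<lambda>\<alpha>. ennreal (1 / (sin \<alpha>)\<^sup>2)) = return borel (pi / 2)"
    by (simp add: density_1)
  have G: "density lborel (\<lambda>(\<theta>, w). ennreal (indicator {0..<2 * pi} \<theta> * g \<theta> w)) = circle_state g"
    unfolding circle_state_def
    by (rule arg_cong[where f = "density lborel"]) (auto simp: indicator_def fun_eq_iff)
  \<comment> \<open>The outer Dirac factor can be collapsed only against a sigma-finite partner,
    here the image measure left by the inner one.\<close>
  have fin: "finite_measure (distr (circle_state g) (borel \<Otimes>\<^sub>M circle_state g) (Pair (0::real)))"
    by (rule finite_measure.finite_measure_distr[OF finite_circle_state]) simp
  have "sets ((borel :: real measure) \<Otimes>\<^sub>M distr (circle_state g) (borel \<Otimes>\<^sub>M circle_state g) (Pair (0::real)))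
      = sets (borel \<Otimes>\<^sub>M borel \<Otimes>\<^sub>M borel)"
    by (simp add: sets_circle_state cong: sets_pair_measure_cong)
  then have sets: "sets (borel \<Otimes>\<^sub>M distr (circle_state g) (borel \<Otimes>\<^sub>M circle_state g) (Pair (0::real)))
      = sets (borel :: (real \<times> real \<times> real \<times> real) measure)"
    by (simp only: borel_prod)
  have swap: "(\<lambda>(\<alpha>, a, \<theta>, w). (\<alpha>, \<theta>, a, w))
      \<in> borel \<Otimes>\<^sub>M distr (circle_state g) (borel \<Otimes>\<^sub>M circle_state g) (Pair 0) \<rightarrow>\<^sub>M
         (borel :: (real \<times> real \<times> real \<times> real) measure)"
    unfolding measurable_cong_sets[OF sets refl] case_prod_unfold
    by (intro borel_measurable_continuous_onI continuous_intros)
  have pair: "(\<lambda>z. (pi / 2, 0 :: real, z)) \<in> circle_state g \<rightarrow>\<^sub>M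
      borel \<Otimes>\<^sub>M distr (circle_state g) (borel \<Otimes>\<^sub>M circle_state g) (Pair 0)"
    by measurable
  have "great_circle_state g = distr (distr (circle_state g)
      (borel \<Otimes>\<^sub>M distr (circle_state g) (borel \<Otimes>\<^sub>M circle_state g) (Pair 0)) (\<lambda>z. (pi / 2, 0, z)))
      borel (\<lambda>(\<alpha>, a, \<theta>, w). (\<alpha>, \<theta>, a, w))"
    unfolding great_circle_state_def a G
    by (simp add: pair_measure_return finite_measure.axioms(1) finite_circle_state fin
        distr_distr comp_def)
  then show ?thesis
    unfolding distr_distr[OF swap pair] by (simp add: comp_def case_prod_unfold)
qed

lemma integrable_great_circle_state:
  fixes H :: "real \<times> real \<times> real \<times> real \<Rightarrow> real"
  assumes "integrable (great_circle_state g) H"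
  shows "set_integrable lborel ({0..<2 * pi} \<times> UNIV)
           (\<lambda>z. g (fst z) (snd z) * H (pi / 2, fst z, 0, snd z))"
    and "(\<integral>z. H z \<partial>great_circle_state g) = circle_pairing g (\<lambda>z. H (pi / 2, fst z, 0, snd z))"
proof -
  \<comment> \<open>Measurability is extracted from integrability. This matters for
    \<open>sphere_transport_dual\<close>, whose coefficients \<open>A\<close> and \<open>B\<close>
    come without any measurability assumption.\<close>
  have [measurable]: "H \<in> borel_measurable borel"
    using assms by (auto simp: great_circle_state_eq)
  have [measurable]: "(\<lambda>z. H (pi / 2, fst z, 0, snd z)) \<in> borel_measurable borel"
    by measurable
  show "set_integrable lborel ({0..<2 * pi} \<times> UNIV)
           (\<lambda>z. g (fst z) (snd z) * H (pi / 2, fst z, 0, snd z))"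
    using assms unfolding great_circle_state_eq
    by (subst (asm) integrable_distr_eq) (simp_all add: integrable_circle_state)
  show "(\<integral>z. H z \<partial>great_circle_state g) = circle_pairing g (\<lambda>z. H (pi / 2, fst z, 0, snd z))"
    unfolding great_circle_state_eq by (subst integral_distr) (simp_all add: integral_circle_state)
qed

lemma spatial_density_great_circle:
  "spatial_density (great_circle_state g) = distr (circle_state g) borel (\<lambda>z. (pi / 2, fst z))"
proof -
  have [measurable]: "(\<lambda>(\<alpha>, \<theta>, a, w). ennreal (sin \<alpha>)) \<in>
      borel_measurable (borel :: (real \<times> real \<times> real \<times> real) measure)"
    unfolding case_prod_unfold
    by (intro measurable_compose[OF _ measurable_ennreal] borel_measurable_continuous_onI continuous_intros)
  have [measurable]: "(\<lambda>(\<alpha>, \<theta>, a, w). (\<alpha>, \<theta>)) \<in>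
      borel_measurable (borel :: (real \<times> real \<times> real \<times> real) measure)"
    unfolding case_prod_unfold
    by (intro borel_measurable_continuous_onI continuous_intros)
  have "density (great_circle_state g) (\<lambda>(\<alpha>, \<theta>, a, w). ennreal (sin \<alpha>)) = great_circle_state g"
    unfolding great_circle_state_eq by (subst density_distr) (simp_all add: density_1)
  then show ?thesis
    unfolding spatial_density_def great_circle_state_eq by (simp add: distr_distr comp_def)
qed

lemma set_integrable_circle_density: "set_integrable lborel {0..<2 * pi} (circle_density g)"
proof -
  have "integrable lborel (\<lambda>\<theta>. \<integral>w. indicator ({0..<2 * pi} \<times> UNIV) (\<theta>, w) * g \<theta> w \<partial>lborel)"
    using lborel_pair.integrable_fst'[of "\<lambda>z. indicator ({0..<2 * pi} \<times> UNIV) z * g (fst z) (snd z)"]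
      circle_distribution_integrable by (simp add: lborel_prod)
  moreover have "(\<integral>w. indicator ({0..<2 * pi} \<times> UNIV) (\<theta>, w) * g \<theta> w \<partial>lborel)
      = indicator {0..<2 * pi} \<theta> *\<^sub>R circle_density g \<theta>" for \<theta>
    by (simp add: circle_density_def indicator_times)
  ultimately show ?thesis by (simp add: set_integrable_def)
qed

lemma circle_pairing_fst:
  assumes "set_integrable lborel ({0..<2 * pi} \<times> UNIV) (\<lambda>z. g (fst z) (snd z) * h (fst z))"
  shows "circle_pairing g (\<lambda>z. h (fst z)) = (LBINT \<theta>:{0..<2 * pi}. h \<theta> * circle_density g \<theta>)"
proof -
  let ?f = "\<lambda>z. indicator ({0..<2 * pi} \<times> UNIV) z *\<^sub>R (g (fst z) (snd z) * h (fst z))"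
  have "(\<integral>w. ?f (\<theta>, w) \<partial>lborel) = indicator {0..<2 * pi} \<theta> *\<^sub>R (h \<theta> * circle_density g \<theta>)" for \<theta>
    by (simp add: circle_density_def indicator_times mult_ac)
  moreover have "circle_pairing g (\<lambda>z. h (fst z)) = (\<integral>\<theta>. \<integral>w. ?f (\<theta>, w) \<partial>lborel \<partial>lborel)"
    unfolding circle_pairing_def set_lebesgue_integral_def
    using lborel_pair.integral_fst'[of ?f] assms by (simp add: lborel_prod set_integrable_def)
  ultimately show ?thesis by (simp add: set_lebesgue_integral_def)
qed

end

section \<open>The potential and the force on the equator\<close>

lemma inner_sphere_point:
  "sphere_point \<alpha> \<theta> \<bullet> sphere_point \<alpha>' \<theta>' =
     sin \<alpha> * cos \<theta> * (sin \<alpha>' * cos \<theta>') + sin \<alpha> * sin \<theta> * (sin \<alpha>' * sin \<theta>') + cos \<alpha> * cos \<alpha>'"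
  by (simp add: sphere_point_def inner_vec_def sum_3)

lemma log_kernel_measurable [measurable]:
  "(\<lambda>p. log_kernel \<alpha> \<theta> (fst p) (snd p)) \<in> borel_measurable borel"
  unfolding log_kernel_def inner_sphere_point
  by (intro borel_measurable_ln borel_measurable_divide borel_measurable_continuous_onI continuous_intros)

text \<open>The inner product is the cosine of the angle difference, and the half-angle formulas
  turn the quotient into a squared cotangent. With \<open>x / 0 = 0\<close> and
  \<open>ln 0 = 0\<close> the identity also holds at coincident and antipodal points.\<close>

lemma log_kernel_equator: "log_kernel (pi / 2) \<theta> (pi / 2) \<theta>' = 4 * pi * W (\<theta> - \<theta>')"
proof -
  let ?x = "(\<theta> - \<theta>') / 2"
  have "2 * ?x = \<theta> - \<theta>'" by simp
  then have "sphere_point (pi / 2) \<theta> \<bullet> sphere_point (pi / 2) \<theta>' = cos (2 * ?x)"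
    by (simp only: inner_sphere_point cos_diff) simp
  moreover have "1 + cos (2 * ?x) = 2 * (cos ?x)\<^sup>2"
    unfolding cos_double_cos by simp
  moreover have "1 - cos (2 * ?x) = 2 * (sin ?x)\<^sup>2"
    unfolding cos_double_sin by simp
  ultimately have "log_kernel (pi / 2) \<theta> (pi / 2) \<theta>' = ln ((\<bar>cot ?x\<bar>)\<^sup>2)"
    by (simp add: log_kernel_def cot_def power_divide)
  also have "\<dots> = 2 * ln \<bar>cot ?x\<bar>"
    using ln_realpow[of "\<bar>cot ?x\<bar>" 2] by (cases "cot ?x = 0") (simp_all del: power2_abs)
  finally show ?thesis by (simp add: W_def)
qed

text \<open>Integrating out the velocity by Fubini's theorem leaves the density, and the prefactor
  \<open>1 / (4 * pi)\<close> cancels the constant of the equatorial kernel. Integrability of the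
  kernel justifies the exchange.\<close>

lemma potential_great_circle:
  assumes g: "circle_distribution_function g"
    and int: "integrable (spatial_density (great_circle_state g))
           (\<lambda>p. log_kernel (pi / 2) \<theta> (fst p) (snd p) * sin (fst p))"
  shows "potential (great_circle_state g) (pi / 2) \<theta> =
           (LBINT x:{0..<2 * pi}. W (\<theta> - x) * circle_density g x)"
proof -
  let ?k = "\<lambda>p. log_kernel (pi / 2) \<theta> (fst p) (snd p) * sin (fst p)"
  let ?h = "\<lambda>x. 4 * pi * W (\<theta> - x)"
  have [measurable]: "?k \<in> borel_measurable borel"
    by (intro borel_measurable_times log_kernel_measurable borel_measurable_continuous_onI continuous_intros)
  have [measurable]: "(\<lambda>z::real \<times> real. (pi / 2, fst z)) \<in> borel_measurable borel"
    by (intro borel_measurable_continuous_onI continuous_intros)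
  have [measurable]: "fst \<in> borel_measurable (borel :: (real \<times> real) measure)"
    by (intro borel_measurable_continuous_onI continuous_intros)
  have h: "(\<lambda>z::real \<times> real. ?h (fst z)) \<in> borel_measurable borel"
    by measurable
  have "integrable (circle_state g) (\<lambda>z. ?h (fst z))"
    using int unfolding spatial_density_great_circle[OF g]
    by (subst (asm) integrable_distr_eq) (simp_all add: log_kernel_equator)
  then have "circle_pairing g (\<lambda>z. ?h (fst z)) = (LBINT x:{0..<2 * pi}. ?h x * circle_density g x)"
    using circle_pairing_fst[OF g] integrable_circle_state[OF g h] by simp
  moreover have "(\<integral>p. ?k p \<partial>spatial_density (great_circle_state g)) = circle_pairing g (\<lambda>z. ?h (fst z))"
    unfolding spatial_density_great_circle[OF g]
    by (subst integral_distr) (auto simp: log_kernel_equator simp flip: integral_circle_state[OF g h])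
  ultimately show ?thesis
    by (simp add: potential_def mult.assoc)
qed

lemma sphere_transport_dual_extension:
  "sphere_transport_dual A B (\<lambda>(\<alpha>, \<theta>, a, w). bump (\<alpha> - pi / 2) * bump a * \<phi> (\<theta>, w))
     (pi / 2, \<theta>, 0, w) = circle_transport_dual (B (pi / 2)) \<phi> (\<theta>, w)"
proof -
  \<comment> \<open>Only the third term needs an argument: the normal force multiplies a bump with
    zero slope. In the others \<open>a = 0\<close>, \<open>cos (pi / 2) = 0\<close> and
    \<open>sin (pi / 2) = 1\<close> suffice.\<close>
  have "((\<lambda>x. A (pi / 2) \<theta> * (bump x * \<phi> (\<theta>, w))) has_real_derivative 0) (at 0)"
    using bump_derivative_0 by (auto intro!: derivative_eq_intros)
  from DERIV_imp_deriv[OF this] show ?thesis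
    by (simp add: sphere_transport_dual_def circle_transport_dual_def bump_0)
qed

lemma represents_equatorial_force:
  assumes g: "circle_distribution_function g"
    and grad: "potential_gradient (great_circle_state g) A B"
  shows "represents (B (pi / 2)) (circle_conv W (dist_deriv (dist_of_fun (circle_density g))))"
proof -
  let ?U = "potential (great_circle_state g) (pi / 2)"
  define V where "V = (\<lambda>\<theta>. LBINT x:{0..<2 * pi}. W (\<theta> - x) * circle_density g x)"
  have "pi / 2 \<in> {0<..<pi}" by simp
  with grad have ae: "AE \<theta> in lborel. integrable (spatial_density (great_circle_state g))
        (\<lambda>p. log_kernel (pi / 2) \<theta> (fst p) (snd p) * sin (fst p))"
    and U: "set_integrable lborel {0..<2 * pi} ?U"
    and B: "represents (B (pi / 2)) (dist_deriv (dist_of_fun ?U))"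
    unfolding potential_gradient_def by blast+
  \<comment> \<open>The kernel is known to be integrable only for almost every angle, which is
    enough, since distributions do not see null sets.\<close>
  have UV: "AE \<theta> in lborel. ?U \<theta> = V \<theta>"
    using ae by eventually_elim (simp add: V_def potential_great_circle[OF g])
  have \<rho>: "(\<lambda>x. indicator {0..<2 * pi} x *\<^sub>R circle_density g x) \<in> borel_measurable borel"
    using set_integrable_circle_density[OF g] by (auto simp: set_integrable_def)
  \<comment> \<open>With the indicator attached to the density the integrand is jointly measurable,
    hence so is the parameter integral.\<close>
  have "V = (\<lambda>\<theta>. \<integral>x. W (\<theta> - x) * (indicator {0..<2 * pi} x *\<^sub>R circle_density g x) \<partial>lborel)"
    by (simp add: V_def set_lebesgue_integral_def mult_ac)
  also have "\<dots> \<in> borel_measurable borel"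
    using \<rho> by measurable
  finally have V: "V \<in> borel_measurable borel" .
  have "dist_of_fun ?U \<psi> = dist_of_fun V \<psi>" if \<psi>: "\<psi> \<in> circle_tests" for \<psi>
    unfolding dist_of_fun_def set_lebesgue_integral_def
  proof (rule integral_cong_AE)
    \<comment> \<open>The potential is known to be measurable only after the cutoff to one period,
      so the indicator is grouped with it.\<close>
    have "(\<lambda>\<theta>. (indicator {0..<2 * pi} \<theta> *\<^sub>R ?U \<theta>) * \<psi> \<theta>) \<in> borel_measurable lborel"
      using U circle_test_measurable[OF \<psi>] by (auto simp: set_integrable_def)
    then show "(\<lambda>\<theta>. indicator {0..<2 * pi} \<theta> *\<^sub>R (?U \<theta> * \<psi> \<theta>)) \<in> borel_measurable lborel"
      by (simp add: mult.assoc)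
    show "(\<lambda>\<theta>. indicator {0..<2 * pi} \<theta> *\<^sub>R (V \<theta> * \<psi> \<theta>)) \<in> borel_measurable lborel"
      using V circle_test_measurable[OF \<psi>] by simp
    show "AE \<theta> in lborel. indicator {0..<2 * pi} \<theta> *\<^sub>R (?U \<theta> * \<psi> \<theta>)
        = indicator {0..<2 * pi} \<theta> *\<^sub>R (V \<theta> * \<psi> \<theta>)"
      using UV by eventually_elim simp
  qed
  then have "dist_deriv (dist_of_fun ?U) \<psi> = circle_conv W (dist_deriv (dist_of_fun (circle_density g))) \<psi>"
    if "\<psi> \<in> circle_tests" for \<psi>
    using circle_conv_dist_deriv[OF set_integrable_circle_density[OF g] that] deriv_circle_test[OF that]
    by (simp add: dist_deriv_def V_def)
  with B show ?thesis by (simp add: represents_def)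
qed

theorem proposition4p1:
  fixes I :: "real set"
    and f :: "real \<Rightarrow> sphere_state"
    and g :: "real \<Rightarrow> real \<Rightarrow> real \<Rightarrow> real"
  assumes "is_interval I"
    and "sphere_VP_solution I f"
    and "\<And>t. t \<in> I \<Longrightarrow> circle_distribution_function (g t)"
    and "\<And>t. t \<in> I \<Longrightarrow> f t = great_circle_state (g t)"
  shows "\<exists>F. circle_VP_solution I g (\<lambda>t. circle_density (g t)) F"
proof -
  note g = assms(3) and f = assms(4)
  obtain A B where grad: "\<And>t. t \<in> I \<Longrightarrow> potential_gradient (f t) (A t) (B t)"
    and test: "\<And>t \<Phi>. t \<in> I \<Longrightarrow> \<Phi> \<in> sphere_phase_tests \<Longrightarrow>
           integrable (f t) \<Phi> \<and>
           integrable (f t) (sphere_transport_dual (A t) (B t) \<Phi>) \<and>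
           ((\<lambda>s. \<integral>z. \<Phi> z \<partial>f s) has_real_derivative
              (\<integral>z. sphere_transport_dual (A t) (B t) \<Phi> z \<partial>f t)) (at t within I)"
    using assms(2) unfolding sphere_VP_solution_def by metis
  \<comment> \<open>The force is the tangential derivative of the potential restricted to the
    equator.\<close>
  have "circle_VP_solution I g (\<lambda>t. circle_density (g t)) (\<lambda>t. B t (pi / 2))"
    unfolding circle_VP_solution_def
  proof (intro ballI conjI)
    fix t \<phi> assume t: "t \<in> I" and \<phi>: "\<phi> \<in> circle_phase_tests"
    define \<Phi> where "\<Phi> = (\<lambda>(\<alpha>, \<theta>, a, w). bump (\<alpha> - pi / 2) * bump a * \<phi> (\<theta>, w))"
    have \<Phi>: "\<Phi> \<in> sphere_phase_tests"
      unfolding \<Phi>_def by (rule sphere_phase_test_extension[OF \<phi>])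
    have restrict: "\<Phi> (pi / 2, fst z, 0, snd z) = \<phi> z" for z
      by (simp add: \<Phi>_def bump_0)
    have dual: "sphere_transport_dual (A t) (B t) \<Phi> (pi / 2, fst z, 0, snd z)
        = circle_transport_dual (B t (pi / 2)) \<phi> z" for z
      unfolding \<Phi>_def sphere_transport_dual_extension by simp
    have pairing: "(\<integral>z. \<Phi> z \<partial>f s) = circle_pairing (g s) \<phi>" if "s \<in> I" for s
      using integrable_great_circle_state(2)[OF g[OF that], of \<Phi>] test[OF that \<Phi>]
      by (simp add: f[OF that] restrict)
    have int: "integrable (great_circle_state (g t)) \<Phi>"
      and int_dual: "integrable (great_circle_state (g t)) (sphere_transport_dual (A t) (B t) \<Phi>)"
      and deriv: "((\<lambda>s. \<integral>z. \<Phi> z \<partial>f s) has_real_derivative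
              (\<integral>z. sphere_transport_dual (A t) (B t) \<Phi> z \<partial>great_circle_state (g t))) (at t within I)"
      using test[OF t \<Phi>] by (simp_all add: f[OF t])
    show "set_integrable lborel ({0..<2 * pi} \<times> UNIV) (\<lambda>z. g t (fst z) (snd z) * \<phi> z)"
      using integrable_great_circle_state(1)[OF g[OF t] int] by (simp add: restrict)
    show "set_integrable lborel ({0..<2 * pi} \<times> UNIV)
        (\<lambda>z. g t (fst z) (snd z) * circle_transport_dual (B t (pi / 2)) \<phi> z)"
      using integrable_great_circle_state(1)[OF g[OF t] int_dual] by (simp add: dual)
    have "((\<lambda>s. \<integral>z. \<Phi> z \<partial>f s) has_real_derivative
        circle_pairing (g t) (circle_transport_dual (B t (pi / 2)) \<phi>)) (at t within I)"
      using deriv integrable_great_circle_state(2)[OF g[OF t] int_dual] by (simp add: dual)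
    then show "((\<lambda>s. circle_pairing (g s) \<phi>) has_real_derivative
        circle_pairing (g t) (circle_transport_dual (B t (pi / 2)) \<phi>)) (at t within I)"
      \<comment> \<open>The pairings agree at all times in \<open>I\<close>, so any positive radius
        serves; 1 is an arbitrary choice.\<close>
      by (rule has_field_derivative_transform_within[OF _ zero_less_one t]) (simp add: pairing)
  next
    fix t assume t: "t \<in> I"
    have "potential_gradient (great_circle_state (g t)) (A t) (B t)"
      using grad[OF t] by (simp add: f[OF t])
    then show "represents (B t (pi / 2)) (circle_conv W (dist_deriv (dist_of_fun (circle_density (g t)))))"
      by (rule represents_equatorial_force[OF g[OF t]])
  qed (simp add: circle_density_def)
  then show ?thesis by blast
qed

end
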